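(* Let $n\geq 1$ be a positive integer and let $\varphi$ denote Euler's totient function. Let $A=\mathbb{Z}/n\mathbb{Z}$, let $A^\times=(\mathbb{Z}/n\mathbb{Z})^\times$, and let $G=A\rtimes A^\times$ be the holomorph of $A$. Then the number $k(G)$ of conjugacy classes of $G$ is $$k(G)=\varphi(n)\sum_{d\mid n}\frac{1}{\varphi(d)},$$ where the sum runs over the positive divisors $d$ of $n$.
   Context: $\mathbb{Z}/n\mathbb{Z}$ is the (additive) cyclic group of order $n$, and $(\mathbb{Z}/n\mathbb{Z})^\times$ is its multiplicative group of units. The holomorph $G=A\rtimes A^\times$ is the set of pairs $(a,u)$ with $a\in A$, $u\in A^\times$, with multiplication $(x,y)(a,u)=(x+ya,\,yu)$; equivalently, it is the group of affine transformations $t\mapsto a+ut$ of $A$. $k(G)$ denotes the class number of $G$, i.e. its number of conjugacy classes. *)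

theory Defs
  imports "HOL-Algebra.Algebra" "HOL-Number_Theory.Totient"
begin

definition affine_group :: "('a, 'b) ring_scheme \<Rightarrow> ('a \<times> 'a) monoid" where
  "affine_group R =
    \<lparr>carrier = carrier R \<times> Units R,
     monoid.mult = (\<lambda>(x, y) (a, u). (x \<oplus>\<^bsub>R\<^esub> (y \<otimes>\<^bsub>R\<^esub> a), y \<otimes>\<^bsub>R\<^esub> u)),
     one = (\<zero>\<^bsub>R\<^esub>, \<one>\<^bsub>R\<^esub>)\<rparr>"

lemma (in ring) group_affine_group: "group (affine_group R)"
proof (rule groupI)
  fix g assume "g \<in> carrier (affine_group R)"
  then obtain a u where g: "g = (a, u)" "a \<in> carrier R" "u \<in> Units R"
    by (auto simp: affine_group_def)
  have "(\<ominus> (inv u \<otimes> a), inv u) \<otimes>\<^bsub>affine_group R\<^esub> g = \<one>\<^bsub>affine_group R\<^esub>"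
    using g by (simp add: affine_group_def l_neg)
  moreover have "(\<ominus> (inv u \<otimes> a), inv u) \<in> carrier (affine_group R)"
    using g by (simp add: affine_group_def)
  ultimately show "\<exists>h\<in>carrier (affine_group R). h \<otimes>\<^bsub>affine_group R\<^esub> g = \<one>\<^bsub>affine_group R\<^esub>"
    by blast
qed (auto simp: affine_group_def Units_closed m_assoc r_distr a_assoc)

text \<open>
  The quotient ring \<open>ZFact (int n)\<close> is used for the integers modulo \<open>n\<close> because, unlike
  \<open>residue_ring (int n)\<close>, it is a ring also for \<open>n = 1\<close> (where \<open>0 = 1\<close> is a unit).
  Its units act on its additive group by multiplication as the full automorphism group.
\<close>

definition holomorph_Zmod :: "nat \<Rightarrow> (int set \<times> int set) monoid" where
  "holomorph_Zmod n = affine_group (ZFact (int n))"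

lemma group_holomorph_Zmod: "group (holomorph_Zmod n)"
  unfolding holomorph_Zmod_def
  by (intro ring.group_affine_group cring.axioms(1) ZFact_is_cring)

definition conjugacy_classes :: "('a, 'b) monoid_scheme \<Rightarrow> 'a set set" where
  "conjugacy_classes G =
    orbits G (carrier G) (\<lambda>g. \<lambda>h \<in> carrier G. g \<otimes>\<^bsub>G\<^esub> h \<otimes>\<^bsub>G\<^esub> inv\<^bsub>G\<^esub> g)"

definition class_number :: "('a, 'b) monoid_scheme \<Rightarrow> nat" where
  "class_number G = card (conjugacy_classes G)"

end

theory Submission
  imports Defs
begin

text \<open>
  Conjugating \<open>(a, u)\<close> by \<open>(x, y)\<close> in the holomorph gives \<open>(y a + (1 - u) x, u)\<close>. So \<open>u\<close> is constant
  on a conjugacy class, and the classes with a given \<open>u\<close> are the orbits of the units on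
  \<open>A / (u - 1) A\<close>, which is the group of integers modulo \<open>g = gcd (u - 1) n\<close>. Every unit modulo
  \<open>g\<close> lifts to a unit modulo \<open>n\<close> (\<open>coprime_lift\<close>), so \<open>a\<close> and \<open>a'\<close> lie in the same orbit exactly
  if \<open>gcd a g = gcd a' g\<close> (\<open>affine_conjugate_int_iff\<close>). Hence the pair of \<open>u mod n\<close> and the divisor
  \<open>gcd a g\<close> of \<open>g\<close> is a complete invariant of conjugacy (\<open>holomorph_Zmod_conjugate_iff\<close>), and the
  classes correspond to the pairs of a unit \<open>u\<close> and a divisor \<open>d\<close> of \<open>n\<close> with \<open>u\<close> congruent to 1
  modulo \<open>d\<close>.

  These pairs are counted by \<open>d\<close>. The units congruent to 1 modulo \<open>d\<close> form the kernel of the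
  reduction of units from modulus \<open>n\<close> to modulus \<open>d\<close>. The reduction is surjective, again by
  \<open>coprime_lift\<close>, so the kernel has \<open>totient n / totient d\<close> elements
  (\<open>card_coprime_residues_cong_1\<close>); the sum over \<open>d\<close> is the formula.
\<close>

section \<open>Conjugacy in affine groups\<close>

text \<open>
  Multiplying out the inverse of the conjugating element spares computing inverses in the
  semidirect product.
\<close>

lemma (in group) conjugation_orbit_iff:
  assumes "h \<in> carrier G" "h' \<in> carrier G"
  shows "h' \<in> orbit G (\<lambda>g. \<lambda>h \<in> carrier G. g \<otimes> h \<otimes> inv g) h \<longleftrightarrow>
    (\<exists>g\<in>carrier G. g \<otimes> h = h' \<otimes> g)"
proof -
  have conj: "g \<otimes> h \<otimes> inv g = h' \<longleftrightarrow> g \<otimes> h = h' \<otimes> g" if "g \<in> carrier G" for g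
    using that assms by (metis inv_solve_right m_closed)
  have "h' \<in> orbit G (\<lambda>g. \<lambda>h \<in> carrier G. g \<otimes> h \<otimes> inv g) h \<longleftrightarrow>
      (\<exists>g\<in>carrier G. g \<otimes> h \<otimes> inv g = h')"
    using assms by (auto simp: orbit_def)
  then show ?thesis
    using conj by simp
qed

lemma (in cring) affine_group_conjugate_iff:
  assumes "(a, u) \<in> carrier (affine_group R)" "(a', u') \<in> carrier (affine_group R)"
  shows "(\<exists>g\<in>carrier (affine_group R).
      g \<otimes>\<^bsub>affine_group R\<^esub> (a, u) = (a', u') \<otimes>\<^bsub>affine_group R\<^esub> g) \<longleftrightarrow>
    u' = u \<and> (\<exists>x\<in>carrier R. \<exists>y\<in>Units R. x \<oplus> y \<otimes> a = a' \<oplus> u \<otimes> x)"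
proof -
  have commute: "y \<otimes> u = u' \<otimes> y \<longleftrightarrow> u' = u" if "y \<in> Units R" for y
    using that assms Units_l_cancel[of y u u']
    by (auto simp: affine_group_def Units_closed m_comm[of y u'])
  show ?thesis
    using assms by (auto simp: affine_group_def commute)
qed

section \<open>Integer representatives of residue classes\<close>

definition residue_class :: "nat \<Rightarrow> int \<Rightarrow> int set" where
  "residue_class n a = Idl\<^bsub>\<Z>\<^esub> {int n} +>\<^bsub>\<Z>\<^esub> a"

lemma residue_class_hom: "residue_class n \<in> ring_hom \<Z> (ZFact (int n))"
  using ideal.rcos_ring_hom[OF int.genideal_ideal, of "{int n}"]
  by (simp add: ZFact_def residue_class_def [abs_def])

lemma residue_class_eq_iff: "residue_class n a = residue_class n b \<longleftrightarrow> [a = b] (mod int n)"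
proof -
  have "residue_class n a = residue_class n b \<longleftrightarrow> a \<ominus>\<^bsub>\<Z>\<^esub> b \<in> Idl\<^bsub>\<Z>\<^esub> {int n}"
    unfolding residue_class_def
    using ring.quotient_eq_iff_same_a_r_cos[OF cring.axioms(1)[OF int.is_cring]
        int.genideal_ideal, of "{int n}" a b]
    by simp
  also have "a \<ominus>\<^bsub>\<Z>\<^esub> b = a - b"
    by (rule int_a_minus_eq)
  also have "a - b \<in> Idl\<^bsub>\<Z>\<^esub> {int n} \<longleftrightarrow> int n dvd a - b"
    by (simp add: Idl_subset_eq_dvd flip: int_Idl_subset_ideal)
  finally show ?thesis
    by (simp add: cong_iff_dvd_diff)
qed

lemma carrier_ZFact: "carrier (ZFact (int n)) = range (residue_class n)"
  by (auto simp: ZFact_def FactRing_def A_RCOSETS_def RCOSETS_def residue_class_def a_r_coset_def)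

lemma residue_class_simps:
  "residue_class n a \<oplus>\<^bsub>ZFact (int n)\<^esub> residue_class n b = residue_class n (a + b)"
  "residue_class n a \<otimes>\<^bsub>ZFact (int n)\<^esub> residue_class n b = residue_class n (a * b)"
  "\<one>\<^bsub>ZFact (int n)\<^esub> = residue_class n 1"
  using ring_hom_add[OF residue_class_hom, of a b n]
    ring_hom_mult[OF residue_class_hom, of a b n]
    ring_hom_one[OF residue_class_hom, of n]
  by simp_all

lemma residue_class_in_Units_iff:
  "residue_class n u \<in> Units (ZFact (int n)) \<longleftrightarrow> coprime u (int n)"
proof -
  have "residue_class n u \<in> Units (ZFact (int n)) \<longleftrightarrow> (\<exists>v. [u * v = 1] (mod int n))"
    by (auto simp: Units_def carrier_ZFact residue_class_simps residue_class_eq_iff mult.commute)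
  then show ?thesis
    by (simp add: coprime_iff_invertible_int)
qed

lemma Units_ZFact: "Units (ZFact (int n)) = residue_class n ` {u. coprime u (int n)}"
proof -
  have "Units (ZFact (int n)) \<subseteq> range (residue_class n)"
    by (auto simp: Units_def carrier_ZFact)
  then show ?thesis
    by (auto simp: residue_class_in_Units_iff)
qed

lemma carrier_holomorph_Zmod:
  "carrier (holomorph_Zmod n) =
    (\<lambda>(a, u). (residue_class n a, residue_class n u)) ` (UNIV \<times> {u. coprime u (int n)})"
  by (auto simp: holomorph_Zmod_def affine_group_def carrier_ZFact Units_ZFact)

section \<open>Orbits of affine conjugation on residues\<close>

text \<open>
  If \<open>m\<close> divides \<open>n\<close>, this is surjectivity of the reduction of units from modulus \<open>n\<close> to \<open>m\<close>.
  A multiple \<open>k m\<close> has to be added to \<open>y\<close> so that no prime divisor of \<open>n\<close> divides the result. The product \<open>k\<close> of the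
  prime divisors of \<open>n\<close> that do not divide \<open>y\<close> does this: every prime divisor of \<open>n\<close> divides exactly
  one of \<open>y\<close> and \<open>k m\<close>, because those that divide \<open>y\<close> do not divide \<open>m\<close>.
\<close>

lemma coprime_lift:
  fixes y m n :: int
  assumes "coprime y m" "n \<noteq> 0"
  obtains z where "[z = y] (mod m)" "coprime z n"
proof -
  define k where "k = \<Prod>{p \<in> prime_factors n. \<not> p dvd y}"
  have "coprime (y + k * m) n"
  proof (rule ccontr)
    assume "\<not> coprime (y + k * m) n"
    then obtain p where p: "Factorial_Ring.prime p" "p dvd y + k * m" "p dvd n"
      using \<open>n \<noteq> 0\<close> prime_divisor_exists[of "gcd (y + k * m) n"] by auto
    have pn: "p \<in> prime_factors n"
      using p \<open>n \<noteq> 0\<close> by (simp add: prime_factors_dvd)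
    show False
    proof (cases "p dvd y")
      case True
      then have "p dvd k * m"
        using p by (simp add: dvd_add_right_iff)
      moreover have "\<not> p dvd m"
        using True \<open>coprime y m\<close> p(1) by (meson coprime_common_divisor not_prime_unit)
      ultimately have "p dvd k"
        using p(1) by (simp add: prime_dvd_mult_iff)
      then obtain q where "q \<in> prime_factors n" "\<not> q dvd y" "p dvd q"
        using p(1) by (auto simp: k_def prime_dvd_prod_iff)
      with True p(1) show False
        by (metis in_prime_factors_imp_prime primes_dvd_imp_eq)
    next
      case False
      with pn have "p dvd k"
        unfolding k_def by (intro dvd_prodI) auto
      with p(2) False show False
        by (simp add: dvd_add_left_iff)
    qed
  qed
  moreover have "[y + k * m = y] (mod m)"
    by (simp add: cong_def)
  ultimately show thesis
    using that by blast
qed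

text \<open>
  Working modulo \<open>n\<close> and up to multiples of \<open>w\<close> means working modulo \<open>g = gcd w n\<close>, where multiplication
  by a unit preserves the gcd with \<open>g\<close>. Conversely, two residues with the same gcd \<open>d\<close> with \<open>g\<close> are
  \<open>d\<close> times units modulo \<open>g / d\<close>; the quotient of these units lifts to a unit modulo \<open>n\<close>.
\<close>

lemma affine_conjugate_int_iff:
  fixes a b w n :: int
  assumes "n \<noteq> 0"
  shows "(\<exists>x y. coprime y n \<and> [b = y * a - w * x] (mod n)) \<longleftrightarrow>
    gcd a (gcd w n) = gcd b (gcd w n)"
proof
  assume "\<exists>x y. coprime y n \<and> [b = y * a - w * x] (mod n)"
  then obtain x y where y: "coprime y n" and b: "[b = y * a - w * x] (mod n)"
    by blast
  let ?g = "gcd w n"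
  have "[b = y * a - w * x] (mod ?g)"
    using b by (rule cong_dvd_modulus) simp
  also have "[y * a - w * x = y * a - 0] (mod ?g)"
    by (intro cong_diff cong_refl) (simp add: cong_0_iff)
  finally have "gcd b ?g = gcd (y * a) ?g"
    by (simp add: cong_gcd_eq)
  also have "\<dots> = gcd a ?g"
    using coprime_divisors[OF dvd_refl _ y, of ?g]
    by (simp add: gcd_mult_left_left_cancel coprime_commute)
  finally show "gcd a ?g = gcd b ?g" ..
next
  let ?g = "gcd w n"
  assume eq: "gcd a ?g = gcd b ?g"
  define d where "d = gcd a ?g"
  have d: "d \<noteq> 0"
    using assms by (auto simp: d_def)
  obtain a' g' where a': "a = a' * d" "?g = g' * d" "coprime a' g'"
    using d unfolding d_def by (metis gcd_coprime_exists)
  obtain b' g'' where b': "b = b' * d" "?g = g'' * d" "coprime b' g''"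
    using d unfolding d_def eq by (metis gcd_coprime_exists)
  have [simp]: "g'' = g'"
    using a' b' d by simp
  \<comment> \<open>The multiplier \<open>y\<close> has to be \<open>b' / a'\<close> modulo \<open>g'\<close>.\<close>
  obtain c where c: "[a' * c = 1] (mod g')"
    using a'(3) coprime_iff_invertible_int by blast
  then have "coprime c g'"
    by (metis coprime_iff_invertible_int mult.commute)
  then have "coprime (c * b') g'"
    using b' by simp
  then obtain y where y: "[y = c * b'] (mod g')" "coprime y n"
    using coprime_lift assms by blast
  have "[y * a' = (c * b') * a'] (mod g')"
    using y(1) by (rule cong_scalar_right)
  also have "[(c * b') * a' = b'] (mod g')"
    using cong_scalar_right[OF c, of b'] by (simp add: mult_ac)
  finally have "g' dvd b' - y * a'"
    by (simp add: cong_iff_dvd_diff dvd_diff_commute)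
  then have "g' * d dvd (b' - y * a') * d"
    by simp
  also have "(b' - y * a') * d = b - y * a"
    unfolding a'(1) b'(1) by (simp add: algebra_simps)
  finally have "?g dvd b - y * a"
    unfolding a'(2) .
  then obtain t where t: "b - y * a = ?g * t" ..
  obtain r s where rs: "r * w + s * n = ?g"
    using bezout_int by blast
  have "b = y * a + (r * w + s * n) * t"
    unfolding rs using t by simp
  also have "\<dots> = y * a - w * (- (r * t)) + n * (s * t)"
    by (simp add: algebra_simps)
  finally have "[b = y * a - w * (- (r * t))] (mod n)"
    by (simp add: cong_def)
  with y(2) show "\<exists>x y. coprime y n \<and> [b = y * a - w * x] (mod n)"
    by blast
qed

section \<open>Units congruent to 1 modulo a divisor\<close>

text \<open>
  Representatives start at 0, so that they are the values of \<open>mod\<close>; the set \<open>totatives\<close>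
  contains 1 instead of 0 for the modulus 1.
\<close>

definition coprime_residues :: "nat \<Rightarrow> int set" where
  "coprime_residues n = {u \<in> {0..<int n}. coprime u (int n)}"

lemma finite_coprime_residues [simp]: "finite (coprime_residues n)"
  by (rule finite_subset[of _ "{0..<int n}"]) (auto simp: coprime_residues_def)

lemma mod_in_coprime_residues:
  assumes "n > 0" "coprime u (int n)"
  shows "u mod int n \<in> coprime_residues n"
  using assms by (simp add: coprime_residues_def)

lemma card_coprime_residues:
  assumes "n > 0"
  shows "card (coprime_residues n) = totient n"
proof (cases "n = 1")
  case True
  then have "coprime_residues n = {0}"
    by (auto simp: coprime_residues_def)
  with True show ?thesis
    by simp
next
  case False
  have "coprime_residues n = int ` totatives n"
  proof (intro equalityI subsetI)
    fix u assume u: "u \<in> coprime_residues n"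
    then have "coprime (nat u) n"
      by (auto simp: coprime_residues_def simp flip: coprime_int_iff)
    moreover from this False have "nat u \<noteq> 0"
      by (auto)
    ultimately have "nat u \<in> totatives n"
      using u by (auto simp: in_totatives_iff coprime_residues_def)
    with u show "u \<in> int ` totatives n"
      by (auto simp: coprime_residues_def intro!: image_eqI[of _ _ "nat u"])
  next
    fix u assume "u \<in> int ` totatives n"
    with False assms show "u \<in> coprime_residues n"
      by (auto simp: coprime_residues_def in_totatives_iff totatives_less)
  qed
  then show ?thesis
    by (simp add: totient_def card_image)
qed

text \<open>
  All fibres of the reduction from modulus \<open>n\<close> to modulus \<open>d\<close> have the size of its kernel:
  multiplication by a lift \<open>w\<close> of \<open>v\<close> maps the kernel bijectively to the fibre over \<open>v\<close>.
\<close>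

lemma card_coprime_residues_cong_1:
  assumes "n > 0" "d dvd n"
  shows "card {u \<in> coprime_residues n. int d dvd u - 1} * totient d = totient n"
proof -
  have "d > 0"
    using assms by (auto intro: Nat.gr0I)
  have dn: "int d dvd int n"
    using assms by simp
  let ?F = "\<lambda>v. {u \<in> coprime_residues n. u mod int d = v}"
  let ?K = "{u \<in> coprime_residues n. int d dvd u - 1}"
  have fibre: "card (?F v) = card ?K" if v: "v \<in> coprime_residues d" for v
  proof -
    obtain w where w: "[w = v] (mod int d)" "coprime w (int n)"
      using v coprime_lift[of v "int d" "int n"] assms by (auto simp: coprime_residues_def)
    obtain w' where w': "[w * w' = 1] (mod int n)"
      using w(2) coprime_iff_invertible_int by blast
    then have cw': "coprime w' (int n)"
      by (metis coprime_iff_invertible_int mult.commute)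
    have wd: "w mod int d = v"
      using w(1) v by (simp add: cong_def coprime_residues_def)
    have w'd: "[w' * w = 1] (mod int d)"
      using cong_dvd_modulus[OF w' dn] by (simp add: mult.commute)
    have "bij_betw (\<lambda>u. (u * w) mod int n) ?K (?F v)"
    proof (rule bij_betw_byWitness[where f' = "\<lambda>u. (u * w') mod int n"])
      have inv: "(u * x mod int n) * y mod int n = u"
        if "u \<in> coprime_residues n" "[x * y = 1] (mod int n)" for u x y
      proof -
        have "[u * (x * y) = u * 1] (mod int n)"
          using that(2) by (rule cong_scalar_left)
        then show ?thesis
          using that(1) by (simp add: cong_def coprime_residues_def mod_mult_left_eq mult.assoc)
      qed
      show "\<forall>u\<in>?K. u * w mod int n * w' mod int n = u"
        using inv w' by blast
      show "\<forall>u\<in>?F v. u * w' mod int n * w mod int n = u"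
        using inv[of _ w' w] w' by (auto simp: mult.commute)
      have closed: "u * x mod int n \<in> coprime_residues n"
        if "u \<in> coprime_residues n" "coprime x (int n)" for u x
        using that assms by (intro mod_in_coprime_residues) (auto simp: coprime_residues_def)
      show "(\<lambda>u. u * w mod int n) ` ?K \<subseteq> ?F v"
      proof clarify
        fix u assume u: "u \<in> coprime_residues n" "int d dvd u - 1"
        have "[u * w = 1 * w] (mod int d)"
          using u(2) by (intro cong_scalar_right) (simp add: cong_iff_dvd_diff)
        then show "u * w mod int n \<in> coprime_residues n \<and> u * w mod int n mod int d = v"
          using closed[OF u(1) w(2)] wd dn by (simp add: cong_def mod_mod_cancel)
      qed
      show "(\<lambda>u. u * w' mod int n) ` ?F v \<subseteq> ?K"
      proof clarify
        fix u assume u: "u \<in> coprime_residues n" "v = u mod int d"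
        have "[u = w] (mod int d)"
          using u(2) wd by (simp add: cong_def)
        then have "[u * w' = w * w'] (mod int d)"
          by (rule cong_scalar_right)
        also have "[w * w' = 1] (mod int d)"
          using w'd by (simp add: mult.commute)
        finally have "[u * w' mod int n = 1] (mod int d)"
          using dn by (simp add: cong_def mod_mod_cancel)
        then show "u * w' mod int n \<in> coprime_residues n \<and> int d dvd u * w' mod int n - 1"
          using closed[OF u(1) cw'] by (simp add: cong_iff_dvd_diff)
      qed
    qed
    then show ?thesis
      by (simp add: bij_betw_same_card)
  qed
  have "u mod int d \<in> coprime_residues d" if "u \<in> coprime_residues n" for u
    using that \<open>d > 0\<close> coprime_divisors[OF dvd_refl dn, of u]
    by (intro mod_in_coprime_residues) (auto simp: coprime_residues_def)
  then have "(\<Sum>v\<in>coprime_residues d. card (?F v)) = card (coprime_residues n)"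
    using sum.group[of "coprime_residues n" "coprime_residues d" "\<lambda>u. u mod int d" "\<lambda>_. 1::nat"]
    by (auto simp: image_subset_iff)
  moreover have "(\<Sum>v\<in>coprime_residues d. card (?F v)) = card (coprime_residues d) * card ?K"
    using fibre by simp
  ultimately show ?thesis
    using assms \<open>d > 0\<close> by (simp add: card_coprime_residues mult.commute)
qed

section \<open>Counting conjugacy classes\<close>

lemma card_image_eq_card_image:
  assumes "\<And>x y. x \<in> S \<Longrightarrow> y \<in> S \<Longrightarrow> f x = f y \<longleftrightarrow> g x = g y"
  shows "card (f ` S) = card (g ` S)"
proof (rule bij_betw_same_card)
  have inv: "g (inv_into S f (f x)) = g x" if "x \<in> S" for x
    using that assms by (metis f_inv_into_f imageI inv_into_into)
  show "bij_betw (g \<circ> inv_into S f) (f ` S) (g ` S)"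
    unfolding bij_betw_def
  proof
    show "inj_on (g \<circ> inv_into S f) (f ` S)"
      using assms inv by (auto intro!: inj_onI)
    show "(g \<circ> inv_into S f) ` f ` S = g ` S"
      using inv by (force simp: image_image)
  qed
qed

text \<open>
  The second component is the divisor of \<open>gcd (u - 1) n\<close> that labels the orbit of \<open>a\<close>; it is a
  natural number because the divisors of \<open>n\<close> in the class number formula are.
\<close>

definition class_invariant :: "nat \<Rightarrow> int \<times> int \<Rightarrow> int \<times> nat" where
  "class_invariant n = (\<lambda>(a, u). (u mod int n, nat (gcd a (gcd (u - 1) (int n)))))"

lemma holomorph_Zmod_conjugate_iff:
  assumes "n > 0" "coprime u (int n)" "coprime u' (int n)"
  defines "G \<equiv> holomorph_Zmod n"
  shows "(residue_class n a', residue_class n u') \<in>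
      orbit G (\<lambda>g. \<lambda>h \<in> carrier G. g \<otimes>\<^bsub>G\<^esub> h \<otimes>\<^bsub>G\<^esub> inv\<^bsub>G\<^esub> g) (residue_class n a, residue_class n u) \<longleftrightarrow>
    class_invariant n (a', u') = class_invariant n (a, u)"
proof -
  interpret Z: cring "ZFact (int n)"
    by (rule ZFact_is_cring)
  let ?r = "residue_class n"
  have carr: "(?r a, ?r u) \<in> carrier G" "(?r a', ?r u') \<in> carrier G"
    using assms by (auto simp: carrier_holomorph_Zmod)
  have G: "G = affine_group (ZFact (int n))"
    by (simp add: G_def holomorph_Zmod_def)
  have step: "?r (x + y * a) = ?r (a' + u * x) \<longleftrightarrow> [a' = y * a - (u - 1) * x] (mod int n)" for x y
  proof -
    have "x + y * a - (a' + u * x) = - (a' - (y * a - (u - 1) * x))"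
      by (simp add: algebra_simps)
    then show ?thesis
      unfolding residue_class_eq_iff cong_iff_dvd_diff by (simp only: dvd_minus_iff)
  qed
  have "(?r a', ?r u') \<in> orbit G (\<lambda>g. \<lambda>h \<in> carrier G. g \<otimes>\<^bsub>G\<^esub> h \<otimes>\<^bsub>G\<^esub> inv\<^bsub>G\<^esub> g) (?r a, ?r u) \<longleftrightarrow>
      (\<exists>g\<in>carrier G. g \<otimes>\<^bsub>G\<^esub> (?r a, ?r u) = (?r a', ?r u') \<otimes>\<^bsub>G\<^esub> g)"
    using group.conjugation_orbit_iff[OF group_holomorph_Zmod] carr unfolding G_def by blast
  also have "\<dots> \<longleftrightarrow> ?r u' = ?r u \<and>
      (\<exists>x y. coprime y (int n) \<and> ?r (x + y * a) = ?r (a' + u * x))"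
    using Z.affine_group_conjugate_iff[of "?r a" "?r u" "?r a'" "?r u'"] carr
    by (auto simp: G Units_ZFact carrier_ZFact residue_class_simps)
  also have "\<dots> \<longleftrightarrow> u' mod int n = u mod int n \<and>
      gcd a (gcd (u - 1) (int n)) = gcd a' (gcd (u - 1) (int n))"
    using affine_conjugate_int_iff[of "int n" a' a "u - 1"] assms(1)
    by (simp add: step) (simp add: residue_class_eq_iff cong_def)
  also have "\<dots> \<longleftrightarrow> class_invariant n (a', u') = class_invariant n (a, u)"
  proof -
    have "gcd (u - 1) (int n) = gcd (u' - 1) (int n)" if "u' mod int n = u mod int n"
      using that by (intro cong_gcd_eq cong_diff cong_refl) (simp add: cong_def)
    then show ?thesis
      by (auto simp: class_invariant_def eq_nat_nat_iff)
  qed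
  finally show ?thesis .
qed

text \<open>
  Every divisor of \<open>n\<close> and \<open>u - 1\<close> occurs as an invariant, since \<open>(d, u)\<close> itself realises \<open>d\<close>.
\<close>

lemma image_class_invariant:
  assumes "n > 0"
  shows "class_invariant n ` (UNIV \<times> {u. coprime u (int n)}) =
    (SIGMA u:coprime_residues n. {d. d dvd n \<and> int d dvd u - 1})"
proof (intro equalityI subsetI)
  fix p assume "p \<in> class_invariant n ` (UNIV \<times> {u. coprime u (int n)})"
  then obtain a u where u: "coprime u (int n)" and p: "p = class_invariant n (a, u)"
    by auto
  define d where "d = gcd a (gcd (u - 1) (int n))"
  have d: "d dvd u - 1" "d dvd int n" "d \<ge> 0"
    unfolding d_def by (auto intro: dvd_trans[OF gcd_dvd2])
  have "[u mod int n = u] (mod d)"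
    using d(2) by (simp add: cong_def mod_mod_cancel)
  then have "d dvd u mod int n - 1"
    using d(1) by (metis cong_iff_dvd_diff cong_trans)
  with d show "p \<in> (SIGMA u:coprime_residues n. {d. d dvd n \<and> int d dvd u - 1})"
    using mod_in_coprime_residues[OF assms u]
    by (auto simp: p class_invariant_def simp flip: d_def) (metis int_dvd_int_iff int_nat_eq)
next
  fix p assume "p \<in> (SIGMA u:coprime_residues n. {d. d dvd n \<and> int d dvd u - 1})"
  then obtain u d where p: "p = (u, d)" and u: "u \<in> coprime_residues n"
    and d: "d dvd n" "int d dvd u - 1"
    by auto
  have "int d dvd gcd (u - 1) (int n)"
    using d by simp
  then have "gcd (int d) (gcd (u - 1) (int n)) = int d"
    by (simp add: gcd_proj1_iff)
  then have "p = class_invariant n (int d, u)"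
    using u by (simp add: p class_invariant_def coprime_residues_def)
  with u show "p \<in> class_invariant n ` (UNIV \<times> {u. coprime u (int n)})"
    by (auto simp: coprime_residues_def)
qed

lemma class_number_holomorph_Zmod:
  assumes "n > 0"
  shows "class_number (holomorph_Zmod n) =
    (\<Sum>d | d dvd n. card {u \<in> coprime_residues n. int d dvd u - 1})"
proof -
  define G where "G = holomorph_Zmod n"
  define S where "S = (UNIV :: int set) \<times> {u. coprime u (int n)}"
  define r where "r = (\<lambda>(a, u). (residue_class n a, residue_class n u))"
  define C where "C = orbit G (\<lambda>g. \<lambda>h \<in> carrier G. g \<otimes>\<^bsub>G\<^esub> h \<otimes>\<^bsub>G\<^esub> inv\<^bsub>G\<^esub> g)"
  interpret G: group G
    unfolding G_def by (rule group_holomorph_Zmod)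
  have carr: "carrier G = r ` S"
    by (simp add: G_def r_def S_def carrier_holomorph_Zmod)
  have conj: "r q \<in> C (r p) \<longleftrightarrow> class_invariant n q = class_invariant n p"
    if "p \<in> S" "q \<in> S" for p q
    using that holomorph_Zmod_conjugate_iff[OF assms]
    by (auto simp: S_def r_def C_def G_def split: prod.splits)
  have sub: "C (r p) \<subseteq> carrier G" if "p \<in> S" for p
  proof -
    have "r p \<in> carrier G"
      using that carr by blast
    then show ?thesis
      by (auto simp: C_def orbit_def)
  qed
  have "C (r p) = C (r q) \<longleftrightarrow> class_invariant n p = class_invariant n q"
    if "p \<in> S" "q \<in> S" for p q
  proof
    assume "C (r p) = C (r q)"
    moreover have "r p \<in> C (r p)"
      using conj that by simp
    ultimately show "class_invariant n p = class_invariant n q"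
      using conj that by simp
  next
    assume eq: "class_invariant n p = class_invariant n q"
    have "x \<in> C (r p) \<longleftrightarrow> x \<in> C (r q)" if x: "x \<in> carrier G" for x
    proof -
      obtain s where "x = r s" "s \<in> S"
        using x unfolding carr by (rule imageE)
      then show ?thesis
        using conj \<open>p \<in> S\<close> \<open>q \<in> S\<close> eq by simp
    qed
    with sub[OF \<open>p \<in> S\<close>] sub[OF \<open>q \<in> S\<close>] show "C (r p) = C (r q)"
      by (intro equalityI subsetI) (meson subsetD)+
  qed
  then have "card ((\<lambda>p. C (r p)) ` S) = card (class_invariant n ` S)"
    by (rule card_image_eq_card_image)
  also have "(\<lambda>p. C (r p)) ` S = conjugacy_classes G"
  proof -
    have "conjugacy_classes G = C ` carrier G"
      unfolding conjugacy_classes_def orbits_def C_def by (rule Setcompr_eq_image)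
    then show ?thesis
      by (simp add: carr image_image)
  qed
  also have "class_invariant n ` S = (SIGMA u:coprime_residues n. {d. d dvd n \<and> int d dvd u - 1})"
    unfolding S_def by (rule image_class_invariant[OF assms])
  also have "card \<dots> = (\<Sum>u\<in>coprime_residues n. card {d. d dvd n \<and> int d dvd u - 1})"
    using assms by (intro card_SigmaI) auto
  also have "\<dots> = (\<Sum>d | d dvd n. card {u \<in> coprime_residues n. int d dvd u - 1})"
    using sum.swap_restrict[of "coprime_residues n" "{d. d dvd n}" "\<lambda>_ _. 1::nat"
        "\<lambda>u d. int d dvd u - 1"] assms
    by simp
  finally show ?thesis
    by (simp add: class_number_def G_def)
qed

theorem theorem23:
  fixes n :: nat
  assumes "n \<ge> 1"
  shows "real (class_number (holomorph_Zmod n)) =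
    real (totient n) * (\<Sum>d | d dvd n. 1 / real (totient d))"
proof -
  have n: "n > 0"
    using assms by simp
  have "real (card {u \<in> coprime_residues n. int d dvd u - 1}) =
      real (totient n) * (1 / real (totient d))" if "d dvd n" for d
  proof -
    have "totient d > 0"
      using that n by (auto intro: Nat.gr0I)
    then show ?thesis
      using card_coprime_residues_cong_1[OF n that]
      by (simp add: field_simps flip: of_nat_mult)
  qed
  then show ?thesis
    by (simp add: class_number_holomorph_Zmod[OF n] sum_distrib_left)
qed

end
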